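(* The myopic heuristic is a $2$-approximation algorithm for submodular stochastic depletion problems: for every submodular stochastic depletion problem, every myopic policy $\pi^g$ and every state $s\in\mathcal S$, $$J^*(s)\le 2\,J^{\pi^g}(s).$$
   Context: Submodular stochastic depletion problem (clairvoyant form). There are $M$ item types, with at most $\bar x_m\in\mathbb Z_+$ items of type $m$, $\bar x=(\bar x_1,\dots,\bar x_M)$; a finite nonempty set $\mathcal A$ of activities; a horizon $T$ (a positive integer); and, for each $A\in\mathcal A$, a fixed known sequence $P_t(A)=(P_{t,1}(A),\dots,P_{t,M}(A))\in[0,1]^M$, $t=0,1,2,\dots$. The state space is $\mathcal S=\{(x,t): x\in\prod_{m}\{0,\dots,\bar x_m\},\ t\in\{0,\dots,T\}\}$; for $s=(x,t)$ write $x(s)=x$, $t(s)=t$. Vector inequalities are componentwise. If activity $A$ is used in state $s=(x,t)$ with $t<T$, a random vector $X_t=(X_{t,m})_m$ of items is depleted, where the $X_{t,m}$ are independent of each other and (given $x$ and $P_t(A)$) of the past, and $X_{t,m}\sim\mathrm{Binomial}(x_m,P_{t,m}(A))$. The next state is $(x-X_t,t+1)$ and the reward earned is $R(s,A)=w(\bar x-x+X_t)-w(\bar x-x)$, where $w:\mathbb Z_+^M\to\mathbb R$ satisfies: (monotonicity) $w(y)\ge w(y')$ whenever $y\ge y'$; (submodularity) for $e\in\mathbb Z_+^M$, $w(y+e)-w(y)\le w(y'+e)-w(y')$ whenever $y\ge y'$. A policy is a map $\pi:\mathcal S\to\mathcal A$; $J^\pi(s)=E\big[\sum_{t'=t(s)}^{T-1}R(S_{t'},\pi(S_{t'}))\mid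 S_{t(s)}=s\big]$, where $S_t$ is the state at time $t$ under $\pi$, and $J^*(s)=\max_\pi J^\pi(s)$. A myopic policy $\pi^g$ is any policy with $\pi^g(s)\in\arg\max_{A\in\mathcal A}E[R(s,A)]$ for every $s$ with $t(s)<T$. *)

theory Defs
  imports "HOL-Probability.Probability" "HOL-Probability.Product_PMF" "HOL-Library.Function_Algebras"
begin

text \<open>
  Item types are the elements of a finite type, so that a vector in $\mathbb{Z}_+^M$ is a function
  \<open>'m \<Rightarrow> nat\<close> with the pointwise order, sum and (truncated) difference. In \<open>prob D t A m\<close> the
  arguments are the period, the activity and the item type.
\<close>

record ('m, 'a) depletion_problem =
  capacity :: "'m \<Rightarrow> nat"
  activities :: "'a set"
  horizon :: nat
  prob :: "nat \<Rightarrow> 'a \<Rightarrow> 'm \<Rightarrow> real"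
  utility :: "('m \<Rightarrow> nat) \<Rightarrow> real"

type_synonym 'm state = "('m \<Rightarrow> nat) \<times> nat"

definition submodular :: "(('m \<Rightarrow> nat) \<Rightarrow> real) \<Rightarrow> bool" where
  "submodular w \<longleftrightarrow> (\<forall>y y' e. y' \<le> y \<longrightarrow> w (y + e) - w y \<le> w (y' + e) - w y')"

definition submodular_depletion_problem :: "('m::finite, 'a) depletion_problem \<Rightarrow> bool" where
  "submodular_depletion_problem D \<longleftrightarrow>
     finite (activities D) \<and> activities D \<noteq> {} \<and>
     0 < horizon D \<and>
     (\<forall>t. \<forall>A\<in>activities D. \<forall>m. prob D t A m \<in> {0..1}) \<and>
     mono (utility D) \<and> submodular (utility D)"

definition states :: "('m::finite, 'a) depletion_problem \<Rightarrow> 'm state set" where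
  "states D = {x. x \<le> capacity D} \<times> {0..horizon D}"

definition depletion ::
  "('m::finite, 'a) depletion_problem \<Rightarrow> 'm state \<Rightarrow> 'a \<Rightarrow> ('m \<Rightarrow> nat) pmf" where
  "depletion D s A = Pi_pmf UNIV 0 (\<lambda>m. binomial_pmf (fst s m) (prob D (snd s) A m))"

definition next_state :: "'m state \<Rightarrow> ('m \<Rightarrow> nat) \<Rightarrow> 'm state" where
  "next_state s X = (fst s - X, Suc (snd s))"

text \<open>
  The random reward $R(s,A)$ is \<open>reward D s X\<close> with \<open>X\<close> distributed as \<open>depletion D s A\<close>.
\<close>

definition reward :: "('m::finite, 'a) depletion_problem \<Rightarrow> 'm state \<Rightarrow> ('m \<Rightarrow> nat) \<Rightarrow> real" where
  "reward D s X = utility D (capacity D - fst s + X) - utility D (capacity D - fst s)"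

definition expected_reward :: "('m::finite, 'a) depletion_problem \<Rightarrow> 'm state \<Rightarrow> 'a \<Rightarrow> real" where
  "expected_reward D s A = measure_pmf.expectation (depletion D s A) (reward D s)"

definition policies :: "('m::finite, 'a) depletion_problem \<Rightarrow> ('m state \<Rightarrow> 'a) set" where
  "policies D = states D \<rightarrow>\<^sub>E activities D"

text \<open>
  The joint law of the first \<open>n\<close> pairs $(S_{t'}, X_{t'})$ of state and depletion under a policy,
  given the initial state.
\<close>

primrec trajectory ::
  "('m::finite, 'a) depletion_problem \<Rightarrow> ('m state \<Rightarrow> 'a) \<Rightarrow> nat \<Rightarrow> 'm state \<Rightarrow>
    ('m state \<times> ('m \<Rightarrow> nat)) list pmf" where
  "trajectory D \<pi> 0 s = return_pmf []"
| "trajectory D \<pi> (Suc n) s =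
     bind_pmf (depletion D s (\<pi> s))
       (\<lambda>X. map_pmf (\<lambda>h. (s, X) # h) (trajectory D \<pi> n (next_state s X)))"

definition policy_value ::
  "('m::finite, 'a) depletion_problem \<Rightarrow> ('m state \<Rightarrow> 'a) \<Rightarrow> 'm state \<Rightarrow> real" where
  "policy_value D \<pi> s =
     measure_pmf.expectation (trajectory D \<pi> (horizon D - snd s) s)
       (\<lambda>h. \<Sum>(s', X)\<leftarrow>h. reward D s' X)"

definition optimal_value :: "('m::finite, 'a) depletion_problem \<Rightarrow> 'm state \<Rightarrow> real" where
  "optimal_value D s = Max ((\<lambda>\<pi>. policy_value D \<pi> s) ` policies D)"

definition myopic_policy ::
  "('m::finite, 'a) depletion_problem \<Rightarrow> ('m state \<Rightarrow> 'a) \<Rightarrow> bool" where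
  "myopic_policy D \<pi> \<longleftrightarrow> \<pi> \<in> policies D \<and>
     (\<forall>s\<in>states D. snd s < horizon D \<longrightarrow>
        is_arg_max (expected_reward D s) (\<lambda>A. A \<in> activities D) (\<pi> s))"

text \<open>The maximum in \<open>optimal_value\<close> is over a finite nonempty set.\<close>

lemma finite_states: "finite (states D)"
proof -
  have "{x. x \<le> capacity D} = (\<Pi>\<^sub>E m\<in>UNIV. {..capacity D m})"
    by (auto simp: le_fun_def PiE_def)
  also have "finite \<dots>" by (intro finite_PiE) auto
  finally show ?thesis by (simp add: states_def)
qed

lemma finite_policies: "submodular_depletion_problem D \<Longrightarrow> finite (policies D)"
  unfolding policies_def submodular_depletion_problem_def
  by (intro finite_PiE finite_states) auto

lemma policies_nonempty: "submodular_depletion_problem D \<Longrightarrow> policies D \<noteq> {}"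
  unfolding policies_def submodular_depletion_problem_def by (auto simp: PiE_eq_empty_iff)

end

theory Submission imports Defs begin

text \<open>
  Let \<open>B n s\<close> be the value of the dynamic programming recursion with \<open>n\<close> periods to go
  (\<open>bellman_value\<close>); it dominates the value of every policy. Write $w$ for the utility and $c$
  for the capacity. The variation of \<open>B\<close> in the stock is bounded on both sides: for
  \<open>y \<le> x \<le> c\<close> and a common period \<open>t\<close>,
  \[ 0 \le B_n(x,t) - B_n(y,t) \le w(c - y) - w(c - x). \]
  Both bounds (\<open>bellman_value_mono\<close>, \<open>bellman_value_le_early_depletion\<close>) follow by induction on
  \<open>n\<close> from a coupling of the depletions at \<open>y\<close> and \<open>x\<close> (\<open>depletion_coupling\<close>): an activity
  depletes at least as much from \<open>x\<close> as from \<open>y\<close>, and the excess comes out of \<open>x - y\<close>. The lower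
  bound uses submodularity: at the larger stock less has been collected, so the same depletion
  earns more. The upper bound needs monotonicity only: $B_n(x,t) + w(c - x)$ is an optimal
  expected final utility, and having depleted \<open>x - y\<close> in advance can only raise it.

  Now compare, in a state \<open>(x, t)\<close>, any activity \<open>A\<close> with the myopic activity, whose random
  depletion is \<open>X\<close>. After \<open>A\<close> the continuation value is at most $B_n(x,t+1)$ by the lower bound,
  hence at most the expected myopic reward plus the expectation of $B_n(x - X,t+1)$ by the upper
  bound. The expected reward of \<open>A\<close> itself is at most the myopic one. So
  $B_{n+1}(x,t)$ is at most two myopic rewards plus the continuation of the recursion after the
  myopic activity, and induction on \<open>n\<close> gives the factor 2.
\<close>

section \<open>Couplings of depletions\<close>

lemma binomial_pmf_add:
  assumes "p \<in> {0..1}"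
  shows "binomial_pmf (a + b) p =
    bind_pmf (binomial_pmf a p) (\<lambda>i. map_pmf (\<lambda>j. i + j) (binomial_pmf b p))"
proof (induction a)
  case 0
  then show ?case using assms by (simp add: binomial_pmf_0 bind_return_pmf map_pmf_idI)
next
  case (Suc a)
  show ?case
    using assms
    by (simp add: binomial_pmf_Suc Suc pair_pmf_def map_bind_pmf bind_map_pmf bind_assoc_pmf
        bind_return_pmf map_pmf_comp add.assoc[symmetric] map_pmf_def[symmetric])
qed

lemma expectation_mono_rel_pmf:
  fixes f :: "'a \<Rightarrow> real" and g :: "'b \<Rightarrow> real"
  assumes "rel_pmf R p q" "finite (set_pmf p)" "finite (set_pmf q)"
    and le: "\<And>u v. R u v \<Longrightarrow> f u \<le> g v"
  shows "measure_pmf.expectation p f \<le> measure_pmf.expectation q g"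
proof -
  from assms(1) obtain r where r: "\<And>u v. (u, v) \<in> set_pmf r \<Longrightarrow> R u v"
    "map_pmf fst r = p" "map_pmf snd r = q"
    by (cases rule: rel_pmf.cases) auto
  have "set_pmf r \<subseteq> set_pmf p \<times> set_pmf q"
    unfolding r(2,3)[symmetric] by force
  with assms have "finite (set_pmf r)" by (meson finite_SigmaI finite_subset)
  then have "measure_pmf.expectation r (\<lambda>z. f (fst z)) \<le> measure_pmf.expectation r (\<lambda>z. g (snd z))"
    by (intro integral_mono_AE integrable_measure_pmf_finite)
      (auto simp: AE_measure_pmf_iff intro!: le r(1))
  then show ?thesis unfolding r(2,3)[symmetric] by simp
qed

lemma le_if_mem_depletion:
  assumes "X \<in> set_pmf (depletion D s A)" "\<And>m. prob D (snd s) A m \<in> {0..1}"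
  shows "X \<le> fst s"
proof (rule le_funI)
  fix m
  have "X m \<in> set_pmf (binomial_pmf (fst s m) (prob D (snd s) A m))"
    using assms(1) by (auto simp: depletion_def set_Pi_pmf PiE_dflt_def)
  then show "X m \<le> fst s m"
    using assms(2)[of m] by (auto simp: set_pmf_binomial_eq split: if_splits)
qed

lemma finite_vectors_le: "finite {X :: 'm::finite \<Rightarrow> nat. X \<le> x}"
proof -
  have "{X. X \<le> x} = (\<Pi>\<^sub>E m\<in>UNIV. {..x m})" by (auto simp: le_fun_def PiE_def)
  also have "finite \<dots>" by (intro finite_PiE) auto
  finally show ?thesis .
qed

lemma finite_depletion:
  assumes "\<And>m. prob D (snd s) A m \<in> {0..1}"
  shows "finite (set_pmf (depletion D s A))"
  using le_if_mem_depletion[OF _ assms] finite_subset[OF _ finite_vectors_le[of "fst s"]]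
  by blast

text \<open>
  The depletion at the larger stock is the depletion at the smaller one plus an independent
  depletion of the difference.
\<close>

lemma depletion_coupling:
  assumes p: "\<And>m. prob D t A m \<in> {0..1}" and "y \<le> x"
  shows "rel_pmf (\<lambda>Y X. Y \<le> y \<and> X \<le> x \<and> Y \<le> X \<and> y - Y \<le> x - X)
    (depletion D (y, t) A) (depletion D (x, t) A)"
proof -
  define K where "K Y = Pi_pmf UNIV 0
    (\<lambda>m. map_pmf (\<lambda>j. Y m + j) (binomial_pmf (x m - y m) (prob D t A m)))" for Y :: "_ \<Rightarrow> nat"
  have x: "x m = y m + (x m - y m)" for m using \<open>y \<le> x\<close> by (auto simp: le_fun_def)
  have "depletion D (x, t) A = Pi_pmf UNIV 0
      (\<lambda>m. bind_pmf (binomial_pmf (y m) (prob D t A m))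
        (\<lambda>i. map_pmf (\<lambda>j. i + j) (binomial_pmf (x m - y m) (prob D t A m))))"
    unfolding depletion_def fst_conv snd_conv
    by (subst x, subst binomial_pmf_add[OF p]) (rule refl)
  also have "\<dots> = bind_pmf (depletion D (y, t) A) K"
    unfolding depletion_def K_def fst_conv snd_conv by (rule Pi_pmf_bind) auto
  finally have dx: "depletion D (x, t) A = bind_pmf (depletion D (y, t) A) K" .
  have K: "Y \<le> X \<and> X \<le> x \<and> y - Y \<le> x - X" if X: "X \<in> set_pmf (K Y)" and "Y \<le> y" for X Y
  proof -
    have "Y m \<le> X m \<and> X m \<le> Y m + (x m - y m)" for m
    proof -
      have "X m \<in> (\<lambda>j. Y m + j) ` set_pmf (binomial_pmf (x m - y m) (prob D t A m))"
        using X by (auto simp: K_def set_Pi_pmf PiE_dflt_def)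
      then show ?thesis
        using p[of m] by (auto simp: set_pmf_binomial_eq split: if_splits)
    qed
    moreover have "Y m \<le> y m \<and> y m \<le> x m" for m using that \<open>y \<le> x\<close> by (auto simp: le_fun_def)
    moreover have "b \<le> a \<and> a \<le> d \<and> c - b \<le> d - a"
      if "b \<le> a \<and> a \<le> b + (d - c)" "b \<le> c \<and> c \<le> d" for a b c d :: nat
      using that by linarith
    ultimately have "Y m \<le> X m \<and> X m \<le> x m \<and> y m - Y m \<le> x m - X m" for m
      by blast
    then show ?thesis by (auto simp: le_fun_def)
  qed
  have "rel_pmf (\<lambda>Y X. Y \<le> y \<and> X \<le> x \<and> Y \<le> X \<and> y - Y \<le> x - X)
    (bind_pmf (depletion D (y, t) A) return_pmf) (bind_pmf (depletion D (y, t) A) K)"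
  proof (rule rel_pmf_bindI)
    show "rel_pmf (\<lambda>Y Y'. Y = Y' \<and> Y \<le> y) (depletion D (y, t) A) (depletion D (y, t) A)"
      by (rule rel_pmf_reflI) (use le_if_mem_depletion[of _ D "(y, t)"] p in auto)
  qed (use K in \<open>auto simp: rel_pmf_return_pmf1\<close>)
  then show ?thesis by (simp add: dx bind_return_pmf')
qed

section \<open>Recursions for the policy value and the optimal value\<close>

text \<open>The expected reward of a policy over the next \<open>n\<close> periods.\<close>

definition value_to_go ::
  "('m::finite, 'a) depletion_problem \<Rightarrow> ('m state \<Rightarrow> 'a) \<Rightarrow> nat \<Rightarrow> 'm state \<Rightarrow> real" where
  "value_to_go D \<pi> n s =
     measure_pmf.expectation (trajectory D \<pi> n s) (\<lambda>h. \<Sum>(s', X)\<leftarrow>h. reward D s' X)"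

text \<open>
  The value of the dynamic programming recursion with \<open>n\<close> periods to go. The period stored in
  the state only selects the depletion probabilities; the horizon plays no role.
\<close>

primrec bellman_value :: "('m::finite, 'a) depletion_problem \<Rightarrow> nat \<Rightarrow> 'm state \<Rightarrow> real" where
  "bellman_value D 0 s = 0"
| "bellman_value D (Suc n) s = Max ((\<lambda>A. measure_pmf.expectation (depletion D s A)
     (\<lambda>X. reward D s X + bellman_value D n (next_state s X))) ` activities D)"

lemma prob_bounds:
  assumes "submodular_depletion_problem D" "A \<in> activities D"
  shows "prob D t A m \<in> {0..1}"
  using assms by (auto simp: submodular_depletion_problem_def)

lemma next_state_in_states:
  assumes "s \<in> states D" "snd s < horizon D"
  shows "next_state s X \<in> states D"
  using assms by (auto simp: next_state_def states_def le_fun_def intro: le_trans[OF diff_le_self])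

lemma finite_trajectory:
  assumes "submodular_depletion_problem D" "\<pi> \<in> policies D" "s \<in> states D" "snd s + n \<le> horizon D"
  shows "finite (set_pmf (trajectory D \<pi> n s))"
  using assms(3,4)
proof (induction n arbitrary: s)
  case (Suc n)
  have A: "\<pi> s \<in> activities D" using assms(2) Suc.prems by (auto simp: policies_def)
  have "finite (set_pmf (trajectory D \<pi> n (next_state s X)))" for X
    by (intro Suc.IH next_state_in_states) (use Suc.prems in \<open>auto simp: next_state_def\<close>)
  moreover have "finite (set_pmf (depletion D s (\<pi> s)))"
    by (rule finite_depletion) (rule prob_bounds[OF assms(1) A])
  ultimately show ?case by simp
qed simp

lemma value_to_go_Suc:
  assumes D: "submodular_depletion_problem D" and "\<pi> \<in> policies D"
    and s: "s \<in> states D" "snd s + Suc n \<le> horizon D"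
  shows "value_to_go D \<pi> (Suc n) s = measure_pmf.expectation (depletion D s (\<pi> s))
    (\<lambda>X. reward D s X + value_to_go D \<pi> n (next_state s X))"
proof -
  have A: "\<pi> s \<in> activities D" using assms by (auto simp: policies_def)
  have fin: "finite (set_pmf (depletion D s (\<pi> s)))"
    by (rule finite_depletion) (rule prob_bounds[OF D A])
  have fint: "finite (set_pmf (trajectory D \<pi> n (next_state s X)))" for X
    by (rule finite_trajectory[OF assms(1,2) next_state_in_states])
      (use s in \<open>auto simp: next_state_def\<close>)
  have "measure_pmf.expectation (trajectory D \<pi> n (next_state s X))
      (\<lambda>h. reward D s X + (\<Sum>(s', X)\<leftarrow>h. reward D s' X))
      = reward D s X + value_to_go D \<pi> n (next_state s X)" for X
    unfolding value_to_go_def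
    by (subst Bochner_Integration.integral_add)
      (auto intro!: integrable_measure_pmf_finite fint)
  then show ?thesis
    unfolding value_to_go_def[of D \<pi> "Suc n"] trajectory.simps
    by (subst pmf_expectation_bind[OF fin])
      (auto simp: fint integral_measure_pmf[OF fin])
qed

lemma bellman_value_Suc_ge:
  assumes "submodular_depletion_problem D" "A \<in> activities D"
  shows "measure_pmf.expectation (depletion D s A)
    (\<lambda>X. reward D s X + bellman_value D n (next_state s X)) \<le> bellman_value D (Suc n) s"
  using assms by (auto simp: submodular_depletion_problem_def intro!: Max_ge)

lemma bellman_value_Suc_le:
  assumes "submodular_depletion_problem D"
    and "\<And>A. A \<in> activities D \<Longrightarrow> measure_pmf.expectation (depletion D s A)
      (\<lambda>X. reward D s X + bellman_value D n (next_state s X)) \<le> c"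
  shows "bellman_value D (Suc n) s \<le> c"
  using assms by (auto simp: submodular_depletion_problem_def)

lemma expectation_depletion_mono:
  fixes f g :: "('m::finite \<Rightarrow> nat) \<Rightarrow> real"
  assumes "submodular_depletion_problem D" "A \<in> activities D"
    and "\<And>X. X \<le> fst s \<Longrightarrow> f X \<le> g X"
  shows "measure_pmf.expectation (depletion D s A) f \<le> measure_pmf.expectation (depletion D s A) g"
  using finite_depletion[OF prob_bounds[OF assms(1,2)]]
    le_if_mem_depletion[OF _ prob_bounds[OF assms(1,2)]] assms(3)
  by (intro integral_mono_AE integrable_measure_pmf_finite) (auto simp: AE_measure_pmf_iff)

lemma expectation_depletion_add:
  fixes f g :: "('m::finite \<Rightarrow> nat) \<Rightarrow> real"
  assumes "submodular_depletion_problem D" "A \<in> activities D"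
  shows "measure_pmf.expectation (depletion D s A) (\<lambda>X. f X + g X) =
    measure_pmf.expectation (depletion D s A) f + measure_pmf.expectation (depletion D s A) g"
  using finite_depletion[OF prob_bounds[OF assms]]
  by (intro Bochner_Integration.integral_add integrable_measure_pmf_finite)

lemma value_to_go_le_bellman_value:
  assumes "submodular_depletion_problem D" "\<pi> \<in> policies D"
    and "s \<in> states D" "snd s + n \<le> horizon D"
  shows "value_to_go D \<pi> n s \<le> bellman_value D n s"
  using assms(3,4)
proof (induction n arbitrary: s)
  case 0
  then show ?case by (simp add: value_to_go_def)
next
  case (Suc n)
  have A: "\<pi> s \<in> activities D" using assms(2) Suc.prems by (auto simp: policies_def)
  have "value_to_go D \<pi> (Suc n) s \<le> measure_pmf.expectation (depletion D s (\<pi> s))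
      (\<lambda>X. reward D s X + bellman_value D n (next_state s X))"
    unfolding value_to_go_Suc[OF assms(1,2) Suc.prems]
    by (intro expectation_depletion_mono[OF assms(1) A] add_left_mono Suc.IH next_state_in_states)
      (use Suc.prems in \<open>auto simp: next_state_def\<close>)
  also have "\<dots> \<le> bellman_value D (Suc n) s" by (rule bellman_value_Suc_ge[OF assms(1) A])
  finally show ?case .
qed

section \<open>Variation of the optimal value in the stock\<close>

lemma bellman_value_mono:
  assumes D: "submodular_depletion_problem D" and "y \<le> x" "x \<le> capacity D"
  shows "bellman_value D n (y, t) \<le> bellman_value D n (x, t)"
  using assms(2,3)
proof (induction n arbitrary: x y t)
  case (Suc n)
  let ?w = "utility D" and ?c = "capacity D"
  have mono_w: "mono ?w" and sub: "submodular ?w"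
    using D by (auto simp: submodular_depletion_problem_def)
  show ?case
  proof (rule bellman_value_Suc_le[OF D])
    fix A assume A: "A \<in> activities D"
    have "measure_pmf.expectation (depletion D (y, t) A)
        (\<lambda>X. reward D (y, t) X + bellman_value D n (next_state (y, t) X))
      \<le> measure_pmf.expectation (depletion D (x, t) A)
        (\<lambda>X. reward D (x, t) X + bellman_value D n (next_state (x, t) X))"
    proof (rule expectation_mono_rel_pmf[OF depletion_coupling])
      fix Y X assume YX: "Y \<le> y \<and> X \<le> x \<and> Y \<le> X \<and> y - Y \<le> x - X"
      have "?c - x \<le> ?c - y" using Suc.prems(1) by (auto simp: le_fun_def diff_le_mono2)
      then have "?w (?c - y + Y) - ?w (?c - y) \<le> ?w (?c - x + Y) - ?w (?c - x)"
        using sub by (auto simp: submodular_def)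
      also have "?w (?c - x + Y) \<le> ?w (?c - x + X)"
        using YX by (intro monoD[OF mono_w]) (auto simp: le_fun_def)
      finally have "reward D (y, t) Y \<le> reward D (x, t) X"
        unfolding reward_def fst_conv by linarith
      moreover have "x - X \<le> ?c"
        using Suc.prems(2) by (auto simp: le_fun_def intro: le_trans[OF diff_le_self])
      ultimately show "reward D (y, t) Y + bellman_value D n (next_state (y, t) Y)
          \<le> reward D (x, t) X + bellman_value D n (next_state (x, t) X)"
        unfolding next_state_def fst_conv snd_conv using YX by (intro add_mono Suc.IH) blast+
    qed (use finite_depletion[OF prob_bounds[OF D A]] prob_bounds[OF D A] Suc.prems in auto)
    also have "\<dots> \<le> bellman_value D (Suc n) (x, t)" by (rule bellman_value_Suc_ge[OF D A])
    finally show "measure_pmf.expectation (depletion D (y, t) A)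
        (\<lambda>X. reward D (y, t) X + bellman_value D n (next_state (y, t) X))
      \<le> bellman_value D (Suc n) (x, t)" .
  qed
qed simp

text \<open>Depleting \<open>x - y\<close> immediately, and collecting its utility, is never worse than waiting.\<close>

lemma bellman_value_le_early_depletion:
  assumes D: "submodular_depletion_problem D" and "y \<le> x" "x \<le> capacity D"
  shows "bellman_value D n (x, t)
    \<le> utility D (capacity D - y) - utility D (capacity D - x) + bellman_value D n (y, t)"
  using assms(2,3)
proof (induction n arbitrary: x y t)
  case 0
  have "utility D (capacity D - x) \<le> utility D (capacity D - y)"
    using D 0 by (intro monoD[of "utility D"])
      (auto simp: submodular_depletion_problem_def le_fun_def diff_le_mono2)
  then show ?case unfolding bellman_value.simps by linarith
next
  case (Suc n)
  let ?w = "utility D" and ?c = "capacity D"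
  \<comment> \<open>Adding the utility collected so far turns rewards into final utilities; the bound then
      compares \<open>x - X\<close> with \<open>y - Y\<close> one period later.\<close>
  have shift: "?c - z + Z = ?c - (z - Z)" if "Z \<le> z" "z \<le> ?c" for z Z
    using that by (auto simp: le_fun_def fun_eq_iff)
  show ?case
  proof (rule bellman_value_Suc_le[OF D])
    fix A assume A: "A \<in> activities D"
    have "measure_pmf.expectation (depletion D (x, t) A)
        (\<lambda>X. reward D (x, t) X + bellman_value D n (next_state (x, t) X))
      \<le> measure_pmf.expectation (depletion D (y, t) A)
        (\<lambda>X. (?w (?c - y) - ?w (?c - x)) +
          (reward D (y, t) X + bellman_value D n (next_state (y, t) X)))"
    proof (rule expectation_mono_rel_pmf)
      show "rel_pmf (\<lambda>X Y. Y \<le> y \<and> X \<le> x \<and> Y \<le> X \<and> y - Y \<le> x - X)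
          (depletion D (x, t) A) (depletion D (y, t) A)"
        using depletion_coupling[OF prob_bounds[OF D A] Suc.prems(1)]
        by (subst pmf.rel_flip[symmetric]) (simp add: conversep_iff[abs_def])
    next
      fix X Y assume YX: "Y \<le> y \<and> X \<le> x \<and> Y \<le> X \<and> y - Y \<le> x - X"
      have "x - X \<le> ?c"
        using Suc.prems(2) by (auto simp: le_fun_def intro: le_trans[OF diff_le_self])
      then have "bellman_value D n (x - X, Suc t)
          \<le> ?w (?c - (y - Y)) - ?w (?c - (x - X)) + bellman_value D n (y - Y, Suc t)"
        using YX by (intro Suc.IH) blast+
      moreover have "?c - (y - Y) = ?c - y + Y" "?c - (x - X) = ?c - x + X"
        using YX Suc.prems shift[of Y y] shift[of X x] by auto
      ultimately show "reward D (x, t) X + bellman_value D n (next_state (x, t) X)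
          \<le> (?w (?c - y) - ?w (?c - x)) +
            (reward D (y, t) Y + bellman_value D n (next_state (y, t) Y))"
        by (simp add: reward_def next_state_def)
    qed (use finite_depletion[OF prob_bounds[OF D A]] in auto)
    also have "\<dots> = ?w (?c - y) - ?w (?c - x) + measure_pmf.expectation (depletion D (y, t) A)
        (\<lambda>X. reward D (y, t) X + bellman_value D n (next_state (y, t) X))"
      by (subst expectation_depletion_add[OF D A]) simp
    also have "\<dots> \<le> ?w (?c - y) - ?w (?c - x) + bellman_value D (Suc n) (y, t)"
      by (intro add_left_mono bellman_value_Suc_ge[OF D A])
    finally show "measure_pmf.expectation (depletion D (x, t) A)
        (\<lambda>X. reward D (x, t) X + bellman_value D n (next_state (x, t) X))
      \<le> ?w (?c - y) - ?w (?c - x) + bellman_value D (Suc n) (y, t)" .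
  qed
qed

section \<open>The myopic policy\<close>

lemma bellman_value_le_twice_myopic:
  assumes D: "submodular_depletion_problem D" and g: "myopic_policy D \<pi>"
    and "s \<in> states D" "snd s + n \<le> horizon D"
  shows "bellman_value D n s \<le> 2 * value_to_go D \<pi> n s"
  using assms(3,4)
proof (induction n arbitrary: s)
  case 0
  then show ?case by (simp add: value_to_go_def)
next
  case (Suc n)
  let ?E = "\<lambda>A. measure_pmf.expectation (depletion D s A)"
    and ?B = "\<lambda>X. bellman_value D n (next_state s X)"
    and ?stay = "bellman_value D n (fst s, Suc (snd s))"
    and ?G = "\<pi> s"
  have \<pi>: "\<pi> \<in> policies D" using g by (simp add: myopic_policy_def)
  have G: "?G \<in> activities D" using \<pi> Suc.prems by (auto simp: policies_def)
  have cap: "fst s \<le> capacity D" using Suc.prems by (auto simp: states_def)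
  have sub: "fst s - X \<le> fst s" for X by (auto simp: le_fun_def)
  have diff: "capacity D - fst s + X = capacity D - (fst s - X)" if "X \<le> fst s" for X
    using that cap by (auto simp: le_fun_def fun_eq_iff)
  \<comment> \<open>Any first activity leaves at most the value of depleting nothing, which the myopic
      depletion recovers at the price of one more myopic reward.\<close>
  have "?stay = ?E ?G (\<lambda>X. ?stay)" by simp
  also have "\<dots> \<le> ?E ?G (\<lambda>X. reward D s X + ?B X)"
  proof (rule expectation_depletion_mono[OF D G])
    fix X assume "X \<le> fst s"
    then show "?stay \<le> reward D s X + ?B X"
      using bellman_value_le_early_depletion[OF D sub cap, of n "Suc (snd s)" X]
      by (simp add: reward_def next_state_def diff)
  qed
  also have "\<dots> = expected_reward D s ?G + ?E ?G ?B"
    by (simp add: expected_reward_def expectation_depletion_add[OF D G])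
  finally have stay: "?stay \<le> expected_reward D s ?G + ?E ?G ?B" .
  have "bellman_value D (Suc n) s \<le> 2 * expected_reward D s ?G + ?E ?G ?B"
  proof (rule bellman_value_Suc_le[OF D])
    fix A assume A: "A \<in> activities D"
    have "?E A ?B \<le> ?E A (\<lambda>X. ?stay)"
      by (rule expectation_depletion_mono[OF D A])
        (simp add: next_state_def bellman_value_mono[OF D sub cap])
    moreover have "expected_reward D s A \<le> expected_reward D s ?G"
      using g Suc.prems A by (auto simp: myopic_policy_def is_arg_max_linorder)
    ultimately show "?E A (\<lambda>X. reward D s X + ?B X) \<le> 2 * expected_reward D s ?G + ?E ?G ?B"
      using stay by (simp add: expectation_depletion_add[OF D A] expected_reward_def)
  qed
  also have "?E ?G ?B \<le> ?E ?G (\<lambda>X. 2 * value_to_go D \<pi> n (next_state s X))"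
    by (intro expectation_depletion_mono[OF D G] Suc.IH next_state_in_states)
      (use Suc.prems in \<open>auto simp: next_state_def\<close>)
  finally show ?case
    by (simp add: value_to_go_Suc[OF D \<pi> Suc.prems] expectation_depletion_add[OF D G]
        expected_reward_def)
qed

theorem mainTheorem5:
  fixes D :: "('m::finite, 'a) depletion_problem"
    and \<pi>g :: "'m state \<Rightarrow> 'a" and s :: "'m state"
  assumes "submodular_depletion_problem D"
    and "myopic_policy D \<pi>g"
    and "s \<in> states D"
  shows "optimal_value D s \<le> 2 * policy_value D \<pi>g s"
proof -
  let ?n = "horizon D - snd s"
  have n: "snd s + ?n \<le> horizon D" using assms(3) by (auto simp: states_def)
  have pv: "policy_value D \<pi> s = value_to_go D \<pi> ?n s" for \<pi>
    by (simp add: policy_value_def value_to_go_def)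
  have "policy_value D \<pi> s \<le> 2 * policy_value D \<pi>g s" if "\<pi> \<in> policies D" for \<pi>
    using value_to_go_le_bellman_value[OF assms(1) that assms(3) n]
      bellman_value_le_twice_myopic[OF assms n] by (simp add: pv)
  then show ?thesis
    unfolding optimal_value_def
    using finite_policies[OF assms(1)] policies_nonempty[OF assms(1)] by auto
qed

end
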